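(* Let $\mathcal{V}$ be a vector space of $\mathbb{R}$-valued random variables and let $\rho$ be a risk measure on $\mathcal{V}$. Put $L:=\{Y\in\mathcal{V}:\rho(|Y|)<\infty\}$. Then $\|\cdot\|:=\rho(|\cdot|)$ is a seminorm on $L$, and $\rho$ is finite valued (i.e. $\mathbb{R}$-valued) on $L$.
   Context: Random variables live on a probability space $(\Omega,\mathcal{F},P)$. The vector space $\mathcal{V}$ contains the constants and is closed under $Y\mapsto|Y|$. A risk measure on $\mathcal{V}$ is a function $\rho:\mathcal{V}\to\mathbb{R}\cup\{+\infty\}$ with $\rho(0)<\infty$ satisfying: (Monotonicity) $\rho(Y_1)\le\rho(Y_2)$ whenever $Y_1\le Y_2$ almost surely; (Positive homogeneity) $\rho(\lambda Y)=\lambda\rho(Y)$ whenever $\lambda>0$; (Convexity) $\rho((1-\lambda)Y_0+\lambda Y_1)\le(1-\lambda)\rho(Y_0)+\lambda\rho(Y_1)$ for $0\le\lambda\le1$; (Translation equivariance) $\rho(Y+c)=\rho(Y)+c$ for $c\in\mathbb{R}$. *)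

theory Defs
  imports "HOL-Probability.Probability" "HOL-Library.Function_Algebras"
begin

text \<open>
  Pointwise scaling, together with the pointwise addition of \<^theory>\<open>HOL-Library.Function_Algebras\<close>,
  makes the functions \<open>'a \<Rightarrow> real\<close> a real vector space.
\<close>

definition scale_fun :: "real \<Rightarrow> ('a \<Rightarrow> real) \<Rightarrow> 'a \<Rightarrow> real" where
  "scale_fun c Y = (\<lambda>\<omega>. c * Y \<omega>)"

global_interpretation fun_space: vector_space "scale_fun :: real \<Rightarrow> ('a \<Rightarrow> real) \<Rightarrow> 'a \<Rightarrow> real"
  by unfold_locales (auto simp: scale_fun_def fun_eq_iff algebra_simps)

definition abs_rv :: "('a \<Rightarrow> real) \<Rightarrow> 'a \<Rightarrow> real" where
  "abs_rv Y = (\<lambda>\<omega>. \<bar>Y \<omega>\<bar>)"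

definition rv_space :: "'a measure \<Rightarrow> ('a \<Rightarrow> real) set \<Rightarrow> bool" where
  "rv_space M V \<longleftrightarrow>
     V \<subseteq> borel_measurable M \<and>
     fun_space.subspace V \<and>
     (\<forall>c. (\<lambda>_. c) \<in> V) \<and>
     (\<forall>Y\<in>V. abs_rv Y \<in> V)"

text \<open>
  The value \<open>-\<infinity>\<close> is excluded explicitly since \<^typ>\<open>ereal\<close> contains it. In the convexity axiom
  the products at \<open>\<lambda> = 0\<close> and \<open>\<lambda> = 1\<close> follow the library's convention \<open>0 * \<infinity> = 0\<close>.
\<close>

definition risk_measure ::
  "'a measure \<Rightarrow> ('a \<Rightarrow> real) set \<Rightarrow> (('a \<Rightarrow> real) \<Rightarrow> ereal) \<Rightarrow> bool" where
  "risk_measure M V \<rho> \<longleftrightarrow>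
     (\<forall>Y\<in>V. \<rho> Y \<noteq> -\<infinity>) \<and>
     \<rho> (\<lambda>_. 0) < \<infinity> \<and>
     (\<forall>Y\<^sub>1\<in>V. \<forall>Y\<^sub>2\<in>V. (AE \<omega> in M. Y\<^sub>1 \<omega> \<le> Y\<^sub>2 \<omega>) \<longrightarrow> \<rho> Y\<^sub>1 \<le> \<rho> Y\<^sub>2) \<and>
     (\<forall>Y\<in>V. \<forall>l>0. \<rho> (\<lambda>\<omega>. l * Y \<omega>) = ereal l * \<rho> Y) \<and>
     (\<forall>Y\<^sub>0\<in>V. \<forall>Y\<^sub>1\<in>V. \<forall>l. 0 \<le> l \<and> l \<le> 1 \<longrightarrow>
        \<rho> (\<lambda>\<omega>. (1 - l) * Y\<^sub>0 \<omega> + l * Y\<^sub>1 \<omega>) \<le> ereal (1 - l) * \<rho> Y\<^sub>0 + ereal l * \<rho> Y\<^sub>1) \<and>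
     (\<forall>Y\<in>V. \<forall>c. \<rho> (\<lambda>\<omega>. Y \<omega> + c) = \<rho> Y + ereal c)"

text \<open>A seminorm on \<open>L\<close> presupposes that \<open>L\<close> is a vector space, so this is part of the notion.\<close>

definition seminorm_on :: "('a \<Rightarrow> real) set \<Rightarrow> (('a \<Rightarrow> real) \<Rightarrow> real) \<Rightarrow> bool" where
  "seminorm_on L p \<longleftrightarrow>
     fun_space.subspace L \<and>
     (\<forall>Y\<in>L. 0 \<le> p Y) \<and>
     (\<forall>Y\<in>L. \<forall>c. p (scale_fun c Y) = \<bar>c\<bar> * p Y) \<and>
     (\<forall>X\<in>L. \<forall>Y\<in>L. p (X + Y) \<le> p X + p Y)"

definition risk_space :: "('a \<Rightarrow> real) set \<Rightarrow> (('a \<Rightarrow> real) \<Rightarrow> ereal) \<Rightarrow> ('a \<Rightarrow> real) set" where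
  "risk_space V \<rho> = {Y \<in> V. \<rho> (abs_rv Y) < \<infinity>}"

end

theory Submission
  imports Defs
begin

text \<open>
  Positive homogeneity and convexity together say that a risk measure is sublinear, and
  homogeneity at the zero variable forces \<open>\<rho> 0 = 0\<close> as soon as \<open>\<rho> 0\<close> is finite. Composed with the
  absolute value, which is itself subadditive, absolutely homogeneous and nonnegative pointwise,
  the monotone sublinear functional \<open>\<rho>\<close> becomes an extended-valued seminorm; the set where such a
  functional is finite is a subspace. On this subspace \<open>\<rho> Y \<le> \<rho> \<bar>Y\<bar>\<close> bounds \<open>\<rho>\<close> from above, while
  the value \<open>-\<infinity>\<close> is excluded by definition.
\<close>

lemma rv_space_const:
  assumes "rv_space M V"
  shows "(\<lambda>_. c) \<in> V"
  using assms by (simp add: rv_space_def)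

lemma rv_space_abs:
  assumes "rv_space M V" "Y \<in> V"
  shows "abs_rv Y \<in> V"
  using assms by (simp add: rv_space_def)

lemma rv_space_add:
  assumes "rv_space M V" "X \<in> V" "Y \<in> V"
  shows "X + Y \<in> V"
  using assms by (simp add: rv_space_def fun_space.subspace_add)

lemma rv_space_scale:
  assumes "rv_space M V" "Y \<in> V"
  shows "scale_fun c Y \<in> V"
  using assms by (simp add: rv_space_def fun_space.subspace_scale)

lemma risk_measure_mono:
  assumes "risk_measure M V \<rho>" "X \<in> V" "Y \<in> V" "\<And>\<omega>. X \<omega> \<le> Y \<omega>"
  shows "\<rho> X \<le> \<rho> Y"
  using assms by (simp add: risk_measure_def)

lemma risk_measure_scale:
  assumes "risk_measure M V \<rho>" "Y \<in> V" "0 < c"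
  shows "\<rho> (scale_fun c Y) = ereal c * \<rho> Y"
  using assms by (simp add: risk_measure_def scale_fun_def)

text \<open>The zero variable is its own double, and \<open>0\<close> is the only finite number with this property.\<close>

lemma risk_measure_zero:
  assumes "rv_space M V" "risk_measure M V \<rho>"
  shows "\<rho> (\<lambda>_. 0) = 0"
proof -
  have "\<rho> (\<lambda>_. 0) = ereal 2 * \<rho> (\<lambda>_. 0)"
    using risk_measure_scale[OF assms(2) rv_space_const[OF assms(1)], of 2 0]
    by (simp add: scale_fun_def)
  moreover have "\<rho> (\<lambda>_. 0) < \<infinity>" "\<rho> (\<lambda>_. 0) \<noteq> -\<infinity>"
    using assms rv_space_const[OF assms(1), of 0] by (simp_all add: risk_measure_def)
  ultimately show ?thesis
    by (cases "\<rho> (\<lambda>_. 0)") auto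
qed

text \<open>A sum is the midpoint of the doubled summands, so convexity gives subadditivity.\<close>

lemma risk_measure_subadditive:
  assumes "rv_space M V" "risk_measure M V \<rho>" "X \<in> V" "Y \<in> V"
  shows "\<rho> (X + Y) \<le> \<rho> X + \<rho> Y"
proof -
  have convex: "\<rho> (\<lambda>\<omega>. (1 - l) * A \<omega> + l * B \<omega>) \<le> ereal (1 - l) * \<rho> A + ereal l * \<rho> B"
    if "A \<in> V" "B \<in> V" "0 \<le> l" "l \<le> 1" for A B and l :: real
    using assms(2) that unfolding risk_measure_def by blast
  have half: "ereal (1/2) * \<rho> (scale_fun 2 Z) = \<rho> Z" if "Z \<in> V" for Z
  proof -
    have "ereal (1/2) * \<rho> (scale_fun 2 Z) = (ereal (1/2) * ereal 2) * \<rho> Z"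
      using risk_measure_scale[OF assms(2) that, of 2] by (simp only: mult.assoc)
    then show ?thesis
      by (simp add: one_ereal_def[symmetric])
  qed
  have "\<rho> (X + Y) = \<rho> (\<lambda>\<omega>. (1 - 1/2) * scale_fun 2 X \<omega> + 1/2 * scale_fun 2 Y \<omega>)"
    by (rule arg_cong[of _ _ \<rho>]) (simp add: fun_eq_iff scale_fun_def)
  also have "\<dots> \<le> ereal (1 - 1/2) * \<rho> (scale_fun 2 X) + ereal (1/2) * \<rho> (scale_fun 2 Y)"
    using assms by (intro convex rv_space_scale) auto
  also have "\<dots> = \<rho> X + \<rho> Y"
    using half[OF assms(3)] half[OF assms(4)] by simp
  finally show ?thesis .
qed

lemma risk_measure_abs_nonneg:
  assumes "rv_space M V" "risk_measure M V \<rho>" "Y \<in> V"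
  shows "0 \<le> \<rho> (abs_rv Y)"
proof -
  have "\<rho> (\<lambda>_. 0) \<le> \<rho> (abs_rv Y)"
    by (intro risk_measure_mono[OF assms(2)] rv_space_const[OF assms(1)]
        rv_space_abs[OF assms(1,3)]) (simp add: abs_rv_def)
  then show ?thesis
    by (simp add: risk_measure_zero[OF assms(1,2)])
qed

text \<open>
  Positive homogeneity leaves out the factor \<open>0\<close>; there the claim is \<open>\<rho> 0 = 0\<close>, which is consistent
  with the convention \<open>0 * \<infinity> = 0\<close>.
\<close>

lemma risk_measure_abs_scale:
  assumes "rv_space M V" "risk_measure M V \<rho>" "Y \<in> V"
  shows "\<rho> (abs_rv (scale_fun c Y)) = ereal \<bar>c\<bar> * \<rho> (abs_rv Y)"
proof (cases "c = 0")
  case True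
  then show ?thesis
    using risk_measure_zero[OF assms(1,2)]
    by (simp add: abs_rv_def scale_fun_def zero_ereal_def[symmetric])
next
  case False
  have "abs_rv (scale_fun c Y) = scale_fun \<bar>c\<bar> (abs_rv Y)"
    by (simp add: abs_rv_def scale_fun_def abs_mult)
  then show ?thesis
    using False risk_measure_scale[OF assms(2) rv_space_abs[OF assms(1,3)], of "\<bar>c\<bar>"] by simp
qed

lemma risk_measure_abs_triangle:
  assumes "rv_space M V" "risk_measure M V \<rho>" "X \<in> V" "Y \<in> V"
  shows "\<rho> (abs_rv (X + Y)) \<le> \<rho> (abs_rv X) + \<rho> (abs_rv Y)"
proof -
  have "\<rho> (abs_rv (X + Y)) \<le> \<rho> (abs_rv X + abs_rv Y)"
    using assms
    by (intro risk_measure_mono[OF assms(2)] rv_space_abs rv_space_add)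
      (auto simp: abs_rv_def abs_triangle_ineq)
  also have "\<dots> \<le> \<rho> (abs_rv X) + \<rho> (abs_rv Y)"
    using assms by (intro risk_measure_subadditive rv_space_abs)
  finally show ?thesis .
qed

lemma risk_space_abs_finite:
  assumes "rv_space M V" "risk_measure M V \<rho>" "Y \<in> risk_space V \<rho>"
  shows "\<bar>\<rho> (abs_rv Y)\<bar> \<noteq> \<infinity>"
  using risk_measure_abs_nonneg[OF assms(1,2), of Y] assms(3) by (auto simp: risk_space_def)

lemma risk_space_subspace:
  assumes "rv_space M V" "risk_measure M V \<rho>"
  shows "fun_space.subspace (risk_space V \<rho>)"
proof (rule fun_space.subspaceI)
  show "0 \<in> risk_space V \<rho>"
    using rv_space_const[OF assms(1), of 0] risk_measure_zero[OF assms]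
    by (simp add: risk_space_def abs_rv_def zero_fun_def)
next
  fix X Y assume XY: "X \<in> risk_space V \<rho>" "Y \<in> risk_space V \<rho>"
  then have V: "X \<in> V" "Y \<in> V" and "\<rho> (abs_rv X) + \<rho> (abs_rv Y) < \<infinity>"
    by (simp_all add: risk_space_def)
  then have "\<rho> (abs_rv (X + Y)) < \<infinity>"
    by (intro le_less_trans[OF risk_measure_abs_triangle[OF assms]])
  then show "X + Y \<in> risk_space V \<rho>"
    using rv_space_add[OF assms(1) V] by (simp add: risk_space_def)
next
  fix c Y assume Y: "Y \<in> risk_space V \<rho>"
  then have "ereal \<bar>c\<bar> * \<rho> (abs_rv Y) < \<infinity>"
    using risk_space_abs_finite[OF assms Y] by auto
  with Y show "scale_fun c Y \<in> risk_space V \<rho>"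
    using risk_measure_abs_scale[OF assms] rv_space_scale[OF assms(1)]
    by (simp add: risk_space_def)
qed

lemma risk_space_seminorm:
  assumes "rv_space M V" "risk_measure M V \<rho>"
  shows "seminorm_on (risk_space V \<rho>) (\<lambda>Y. real_of_ereal (\<rho> (abs_rv Y)))"
  unfolding seminorm_on_def
proof (intro conjI ballI allI)
  show "fun_space.subspace (risk_space V \<rho>)"
    by (rule risk_space_subspace[OF assms])
next
  fix Y assume "Y \<in> risk_space V \<rho>"
  then show "0 \<le> real_of_ereal (\<rho> (abs_rv Y))"
    using risk_measure_abs_nonneg[OF assms] by (simp add: risk_space_def real_of_ereal_pos)
next
  fix Y c assume "Y \<in> risk_space V \<rho>"
  then show "real_of_ereal (\<rho> (abs_rv (scale_fun c Y))) = \<bar>c\<bar> * real_of_ereal (\<rho> (abs_rv Y))"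
    using risk_measure_abs_scale[OF assms] by (simp add: risk_space_def)
next
  fix X Y assume XY: "X \<in> risk_space V \<rho>" "Y \<in> risk_space V \<rho>"
  then have "X + Y \<in> risk_space V \<rho>"
    by (rule fun_space.subspace_add[OF risk_space_subspace[OF assms]])
  \<comment> \<open>All three values are finite, so the inequality in \<^typ>\<open>ereal\<close> is one between real numbers.\<close>
  note finite = risk_space_abs_finite[OF assms this] XY[THEN risk_space_abs_finite[OF assms]]
  have "\<rho> (abs_rv (X + Y)) \<le> \<rho> (abs_rv X) + \<rho> (abs_rv Y)"
    using XY by (intro risk_measure_abs_triangle[OF assms]) (simp_all add: risk_space_def)
  with finite show "real_of_ereal (\<rho> (abs_rv (X + Y)))
      \<le> real_of_ereal (\<rho> (abs_rv X)) + real_of_ereal (\<rho> (abs_rv Y))"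
    by (cases "\<rho> (abs_rv (X + Y))"; cases "\<rho> (abs_rv X)"; cases "\<rho> (abs_rv Y)") simp_all
qed

lemma risk_space_finite:
  assumes "rv_space M V" "risk_measure M V \<rho>" "Y \<in> risk_space V \<rho>"
  shows "\<bar>\<rho> Y\<bar> \<noteq> \<infinity>"
proof -
  have Y: "Y \<in> V" "\<rho> (abs_rv Y) < \<infinity>"
    using assms(3) by (simp_all add: risk_space_def)
  have "\<rho> Y \<le> \<rho> (abs_rv Y)"
    using Y(1) by (intro risk_measure_mono[OF assms(2)] rv_space_abs[OF assms(1)])
      (auto simp: abs_rv_def)
  moreover have "\<rho> Y \<noteq> -\<infinity>"
    using assms(2) Y(1) by (simp add: risk_measure_def)
  ultimately show ?thesis
    using Y(2) by auto
qed

theorem proposition5: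
  fixes M :: "'a measure" and V :: "('a \<Rightarrow> real) set" and \<rho> :: "('a \<Rightarrow> real) \<Rightarrow> ereal"
  assumes "prob_space M"
    and "rv_space M V"
    and "risk_measure M V \<rho>"
  shows "(\<forall>Y \<in> risk_space V \<rho>. \<bar>\<rho> (abs_rv Y)\<bar> \<noteq> \<infinity>) \<and>
         seminorm_on (risk_space V \<rho>) (\<lambda>Y. real_of_ereal (\<rho> (abs_rv Y))) \<and>
         (\<forall>Y \<in> risk_space V \<rho>. \<bar>\<rho> Y\<bar> \<noteq> \<infinity>)"
  by (intro conjI ballI risk_space_abs_finite[OF assms(2,3)] risk_space_seminorm[OF assms(2,3)]
      risk_space_finite[OF assms(2,3)])

end
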